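(* For $n,k\ge 0$ let $a^{213}_{n,k}$ be the number of permutations $\sigma\in S_n$ that avoid the classical pattern $3\textrm{-}1\textrm{-}2$ and contain exactly $k$ occurrences of the consecutive pattern $213$, and let $A^{213}(t,z)=\sum_{n,k\ge 0}a^{213}_{n,k}t^nz^k$. Then $$A^{213}(t,z)=\frac{1-2t+2tz-\sqrt{(1-2t)^2-4t^2z}}{2tz},$$ and for all $n\ge 1$ and $k\ge 0$, $$a^{213}_{n,k}=2^{n-2k-1}C_k\binom{n-1}{2k},$$ where $C_k=\frac{1}{k+1}\binom{2k}{k}$ is the $k$-th Catalan number.
   Context: A permutation $\sigma\in S_n$ avoids the classical pattern $3\textrm{-}1\textrm{-}2$ if there are no indices $i<j<l$ with $\sigma(j)<\sigma(l)<\sigma(i)$; $S_n(3\textrm{-}1\textrm{-}2)$ denotes the set of such permutations. For $\tau\in S_3$, an occurrence of the consecutive pattern $\tau$ in $\sigma\in S_n$ is an index $i$ with $1\le i\le n-2$ such that $\sigma(i)\sigma(i+1)\sigma(i+2)$ is order-isomorphic to $\tau$ (i.e. $\sigma(i+a-1)<\sigma(i+b-1)$ iff $\tau(a)<\tau(b)$). *)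

theory Defs
  imports
    "HOL-Combinatorics.Permutations"
    "HOL-Computational_Algebra.Formal_Laurent_Series"
begin

definition avoids_312 :: "nat \<Rightarrow> (nat \<Rightarrow> nat) \<Rightarrow> bool" where
  "avoids_312 n \<sigma> \<longleftrightarrow>
     \<not> (\<exists>i j l. 1 \<le> i \<and> i < j \<and> j < l \<and> l \<le> n \<and> \<sigma> j < \<sigma> l \<and> \<sigma> l < \<sigma> i)"

definition Av312 :: "nat \<Rightarrow> (nat \<Rightarrow> nat) set" where
  "Av312 n = {\<sigma>. \<sigma> permutes {1..n} \<and> avoids_312 n \<sigma>}"

definition consec_occs :: "(nat \<Rightarrow> nat) \<Rightarrow> nat \<Rightarrow> (nat \<Rightarrow> nat) \<Rightarrow> nat set" where
  "consec_occs \<tau> n \<sigma> =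
     {i. 1 \<le> i \<and> i + 2 \<le> n \<and>
         (\<forall>a\<in>{1..3}. \<forall>b\<in>{1..3}. \<sigma> (i + a - 1) < \<sigma> (i + b - 1) \<longleftrightarrow> \<tau> a < \<tau> b)}"

definition pat213 :: "nat \<Rightarrow> nat" where
  "pat213 = id(1 := 2, 2 := 1, 3 := 3)"

lemma pat213_permutes: "pat213 permutes {1..3}"
proof -
  have "pat213 = Transposition.transpose 1 2"
    by (auto simp: fun_eq_iff pat213_def transpose_def)
  moreover have "Transposition.transpose 1 2 permutes {1..3::nat}"
    by (rule permutes_swap_id) auto
  ultimately show ?thesis by simp
qed

definition a213 :: "nat \<Rightarrow> nat \<Rightarrow> nat" where
  "a213 n k = card {\<sigma> \<in> Av312 n. card (consec_occs pat213 n \<sigma>) = k}"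

text \<open>
  Bivariate series in \<open>t\<close> and \<open>z\<close> have type \<open>rat fps fps\<close>: the outer variable is \<open>t\<close>, the inner
  one \<open>z\<close>, so the coefficient of \<open>t\<^sup>n z\<^sup>k\<close> in \<open>F\<close> is \<open>F $ n $ k\<close>.
\<close>

definition A213 :: "rat fps fps" where
  "A213 = Abs_fps (\<lambda>n. Abs_fps (\<lambda>k. of_nat (a213 n k)))"

text \<open>
  In \<open>rat fps fps\<close> the library's division by \<open>2tz\<close> is not meaningful, as \<open>z\<close> has no inverse
  in \<open>rat fps\<close>. Closed forms with such denominators are therefore stated in the larger ring of power
  series in \<open>t\<close> over the field of formal Laurent series in \<open>z\<close>, of type \<open>rat fls fps\<close>.
\<close>

definition embed_z :: "rat fps fps \<Rightarrow> rat fls fps" where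
  "embed_z F = Abs_fps (\<lambda>n. fps_to_fls (F $ n))"

lemma inj_embed_z: "inj embed_z"
  by (auto simp: inj_def embed_z_def fps_eq_iff[where 'a = "rat fls"] intro!: fps_ext)

definition var_t :: "rat fls fps" where
  "var_t = fps_X"

definition var_z :: "rat fls fps" where
  "var_z = fps_const fls_X"

text \<open>
  Square root of a power series with constant term 1, with the branch whose constant term is 1;
  the first argument of \<open>fps_radical\<close> selects the root of the constant term.
\<close>

definition fps_sqrt :: "'a::field_char_0 fps \<Rightarrow> 'a fps" where
  "fps_sqrt F = fps_radical (\<lambda>_ _. 1) 2 F"

lemma fps_sqrt_unique:
  assumes "F $ 0 = 1"
  shows "S = fps_sqrt F \<longleftrightarrow> S ^ 2 = F \<and> S $ 0 = 1"
  using radical_unique[of "\<lambda>_ _. 1" 1 F S] assms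
  by (auto simp: fps_sqrt_def numeral_2_eq_2)

text \<open>
  The quotient in the closed form of the generating function is exact, so that the library's
  truncating division \<open>/\<close> on power series is the honest quotient there.
\<close>

lemma closed_form_dvd:
  "2 * var_t * var_z dvd
     1 - 2 * var_t + 2 * var_t * var_z - fps_sqrt ((1 - 2 * var_t)^2 - 4 * var_t^2 * var_z)"
  (is "?d dvd ?N")
proof -
  let ?F = "(1 - 2 * var_t)^2 - 4 * var_t^2 * var_z"
  have "?F $ 0 = 1" by (simp add: var_t_def power2_eq_square)
  hence "fps_sqrt ?F $ 0 = 1" using fps_sqrt_unique by blast
  hence "?N $ 0 = 0" by (simp add: var_t_def)
  hence "subdegree ?N \<ge> 1 \<or> ?N = 0"
    by (metis One_nat_def Suc_leI nth_subdegree_nonzero not_gr_zero)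
  hence "fps_X dvd ?N"
    using fps_dvd_iff[of "fps_X :: rat fls fps" ?N]
    by (cases "?N = 0") (simp_all only: dvd_0_right fps_X_neq_zero
        subdegree_fps_X simp_thms not_False_eq_True)
  moreover have "?d dvd fps_X"
  proof -
    have "(fps_X :: rat fls fps) = ?d * fps_const (inverse (2 * fls_X))"
      by (simp add: var_t_def var_z_def numeral_fps_const mult.assoc del: fps_const_mult)
    thus ?thesis by (rule dvdI)
  qed
  ultimately show ?thesis by (rule dvd_trans[rotated])
qed

definition catalan :: "nat \<Rightarrow> rat" where
  "catalan k = 1 / of_nat (k + 1) * of_nat ((2 * k) choose k)"

end

theory Submission
  imports Defs
begin

text \<open>
  If \<open>\<sigma>\<close> avoids 3-1-2 then every entry to the left of the entry 1 is smaller than every entry to its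
  right, so \<open>\<sigma> = L 1 R\<close> with two arbitrary smaller avoiders \<open>L\<close> and \<open>R\<close>. The consecutive occurrences
  of 213 are those of \<open>L\<close>, those of \<open>R\<close>, and one more centred at 1 if neither part is empty. Hence
  \<open>B = A - 1\<close> satisfies \<open>B = t (1 + 2 B + z B\<^sup>2)\<close>, which gives the closed form. Reading the equation
  by powers of \<open>z\<close> shows that the coefficient of \<open>z\<^sup>k\<close> in \<open>B\<close> is \<open>C\<^sub>k (t / (1 - 2 t))\<^bsup>2k+1\<^esup>\<close>.
\<close>

section \<open>Decomposition at the entry 1\<close>

text \<open>Middle < first < last determines the relative order of all three entries, so two
  inequalities replace the nine comparisons.\<close>

lemma consec_occs_pat213:
  "consec_occs pat213 n \<sigma> = {i. 1 \<le> i \<and> i + 2 \<le> n \<and> \<sigma> (i + 1) < \<sigma> i \<and> \<sigma> i < \<sigma> (i + 2)}"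
proof -
  have *: "{1..3} = {1, 2, 3 :: nat}" by auto
  show ?thesis
    unfolding consec_occs_def * by (auto simp: pat213_def)
qed

lemma finite_consec_occs: "finite (consec_occs \<tau> n \<sigma>)"
  by (rule finite_subset[of _ "{..n}"]) (auto simp: consec_occs_def)

lemma finite_Av312: "finite (Av312 n)"
  by (rule finite_subset[OF _ finite_permutations[of "{1..n}"]]) (auto simp: Av312_def)

section \<open>Joining two permutations around the entry 1\<close>

text \<open>The word L 1 R: L is raised to the values 2..m+1 and R to m+2..m+r+1. The case
  \<open>i = 0\<close> and the last case fix everything outside the interval, as
  \<open>permutes\<close> demands.\<close>

definition join_at_1 :: "nat \<Rightarrow> nat \<Rightarrow> (nat \<Rightarrow> nat) \<Rightarrow> (nat \<Rightarrow> nat) \<Rightarrow> nat \<Rightarrow> nat" where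
  "join_at_1 m r L R i =
     (if i = 0 then 0 else if i \<le> m then Suc (L i) else if i = Suc m then 1
      else if i \<le> Suc (m + r) then R (i - Suc m) + Suc m else i)"

lemma permutes_bounds:
  assumes "p permutes {1..n}" "1 \<le> i" "i \<le> n"
  shows "1 \<le> p i" "p i \<le> n"
  using permutes_in_image[OF assms(1), of i] assms(2,3) by auto

lemma permutes_eq_iff:
  assumes "p permutes S"
  shows "p x = p y \<longleftrightarrow> x = y"
  using permutes_inj[OF assms] by (auto dest: injD)

lemma permutes_atLeastAtMostI:
  fixes f :: "nat \<Rightarrow> nat"
  assumes "inj_on f {1..n}" "\<And>i. 1 \<le> i \<Longrightarrow> i \<le> n \<Longrightarrow> 1 \<le> f i \<and> f i \<le> n"
    and "\<And>i. i \<notin> {1..n} \<Longrightarrow> f i = i"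
  shows "f permutes {1..n}"
proof (rule bij_imp_permutes)
  have "f ` {1..n} = {1..n}"
    by (rule endo_inj_surj) (use assms in auto)
  thus "bij_betw f {1..n} {1..n}" using assms(1) by (simp add: bij_betw_def)
qed (use assms in auto)

lemma join_at_1_simps:
  "join_at_1 m r L R (Suc m) = 1"
  "1 \<le> i \<Longrightarrow> i \<le> m \<Longrightarrow> join_at_1 m r L R i = Suc (L i)"
  "1 \<le> i \<Longrightarrow> i \<le> r \<Longrightarrow> join_at_1 m r L R (Suc (m + i)) = R i + Suc m"
  by (auto simp: join_at_1_def)

lemma join_index_cases:
  assumes "1 \<le> i" "i \<le> Suc (m + r)"
  obtains (left) "1 \<le> i" "i \<le> m" | (mid) "i = Suc m"
    | (right) i' where "i = Suc (m + i')" "1 \<le> i'" "i' \<le> r"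
proof -
  consider "i \<le> m" | "i = Suc m" | "i > Suc m" by linarith
  thus thesis
  proof cases
    case 3
    thus thesis using assms by (intro right[of "i - Suc m"]) auto
  qed (use assms left mid in auto)
qed

text \<open>The left block, the entry 1 and the right block take values in disjoint ranges, so equal
  values lie in the same block, where injectivity of \<open>L\<close> or \<open>R\<close>
  applies.\<close>

lemma join_at_1_permutes:
  assumes L: "L permutes {1..m}" and R: "R permutes {1..r}"
  shows "join_at_1 m r L R permutes {1..Suc (m + r)}"
proof (rule permutes_atLeastAtMostI)
  show "inj_on (join_at_1 m r L R) {1..Suc (m + r)}"
  proof (rule inj_onI)
    fix i j assume ij: "i \<in> {1..Suc (m + r)}" "j \<in> {1..Suc (m + r)}"
      and eq: "join_at_1 m r L R i = join_at_1 m r L R j"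
    have i: "1 \<le> i" "i \<le> Suc (m + r)" and j: "1 \<le> j" "j \<le> Suc (m + r)" using ij by auto
    show "i = j" using i
    proof (cases rule: join_index_cases)
      case left
      note a = permutes_bounds[OF L left]
      from j show ?thesis
      proof (cases rule: join_index_cases)
        case (right j')
        thus ?thesis using eq left a permutes_bounds[OF R, of j'] by (simp add: join_at_1_simps)
      qed (use eq left a permutes_eq_iff[OF L] in \<open>auto simp: join_at_1_simps\<close>)
    next
      case mid
      from j show ?thesis
      proof (cases rule: join_index_cases)
        case left
        thus ?thesis using eq mid permutes_bounds[OF L left] by (simp add: join_at_1_simps)
      next
        case (right j')
        thus ?thesis using eq mid permutes_bounds[OF R, of j'] by (simp add: join_at_1_simps)
      qed (use mid in auto)
    next
      case (right i')
      note a = permutes_bounds[OF R right(2,3)]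
      from j show ?thesis
      proof (cases rule: join_index_cases)
        case left
        thus ?thesis using eq right a permutes_bounds[OF L left] by (simp add: join_at_1_simps)
      qed (use eq right a permutes_eq_iff[OF R] in \<open>auto simp: join_at_1_simps\<close>)
    qed
  qed
next
  fix i assume "1 \<le> i" "i \<le> Suc (m + r)"
  thus "1 \<le> join_at_1 m r L R i \<and> join_at_1 m r L R i \<le> Suc (m + r)"
  proof (cases rule: join_index_cases)
    case left
    thus ?thesis using permutes_bounds[OF L left] by (simp add: join_at_1_simps)
  next
    case (right i')
    thus ?thesis using permutes_bounds[OF R right(2,3)] by (simp add: join_at_1_simps)
  qed (simp add: join_at_1_simps)
qed (auto simp: join_at_1_def)

text \<open>Shifting a block preserves its patterns. Conversely, the last entry of a 3-1-2 is not
  the minimum, so it is not the 1. If it lies in L, so does the whole occurrence; if it lies in R,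
  the larger first entry must lie in R too, and hence the middle one.\<close>

lemma avoids_312_join_at_1:
  assumes L: "L permutes {1..m}" and R: "R permutes {1..r}"
  shows "avoids_312 (Suc (m + r)) (join_at_1 m r L R) \<longleftrightarrow> avoids_312 m L \<and> avoids_312 r R"
proof (intro iffI conjI)
  let ?J = "join_at_1 m r L R"
  assume av: "avoids_312 (Suc (m + r)) ?J"
  show "avoids_312 m L"
    unfolding avoids_312_def
  proof clarify
    fix i j l assume *: "1 \<le> i" "i < j" "j < l" "l \<le> m" "L j < L l" "L l < L i"
    hence "?J j < ?J l" "?J l < ?J i" by (simp_all add: join_at_1_simps)
    with av * show False
      unfolding avoids_312_def by (meson le_SucI trans_le_add1)
  qed
  show "avoids_312 r R"
    unfolding avoids_312_def
  proof clarify
    fix i j l assume *: "1 \<le> i" "i < j" "j < l" "l \<le> r" "R j < R l" "R l < R i"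
    hence "?J (Suc (m + j)) < ?J (Suc (m + l))" "?J (Suc (m + l)) < ?J (Suc (m + i))"
      by (simp_all add: join_at_1_simps)
    moreover have "1 \<le> Suc (m + i)" "Suc (m + i) < Suc (m + j)" "Suc (m + j) < Suc (m + l)"
      "Suc (m + l) \<le> Suc (m + r)" using * by auto
    ultimately show False using av unfolding avoids_312_def by blast
  qed
next
  let ?J = "join_at_1 m r L R"
  assume av: "avoids_312 m L \<and> avoids_312 r R"
  show "avoids_312 (Suc (m + r)) ?J"
    unfolding avoids_312_def
  proof clarify
    fix i j l assume *: "1 \<le> i" "i < j" "j < l" "l \<le> Suc (m + r)" "?J j < ?J l" "?J l < ?J i"
    have "1 \<le> l" using * by auto
    from this *(4) show False
    proof (cases rule: join_index_cases)
      case left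
      hence "L j < L l" "L l < L i" using * by (simp_all add: join_at_1_simps)
      thus False using av * left unfolding avoids_312_def by blast
    next
      case mid
      hence "L j < 0" using * by (simp add: join_at_1_simps)
      thus False by simp
    next
      case (right l')
      note a = permutes_bounds[OF R right(2,3)]
      have i: "1 \<le> i" "i \<le> Suc (m + r)" using * by auto
      from i show False
      proof (cases rule: join_index_cases)
        case left
        thus False using permutes_bounds[OF L left] * a right by (simp add: join_at_1_simps)
      next
        case mid
        thus False using * a right by (simp add: join_at_1_simps)
      next
        case r': (right i')
        have "1 \<le> j" "j \<le> Suc (m + r)" using * by auto
        then obtain j' where j: "j = Suc (m + j')" "1 \<le> j'" "j' \<le> r"
          by (cases rule: join_index_cases) (use * r' in auto)
        have "R j' < R l'" "R l' < R i'" using * right r' j by (simp_all add: join_at_1_simps)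
        moreover have "i' < j'" "j' < l'" using * right r' j by auto
        ultimately show False using av right r' unfolding avoids_312_def by blast
      qed
    qed
  qed
qed

text \<open>A window containing the 1 can only be an occurrence with the 1 in its middle, that is,
  starting at m. It then needs an entry on either side, and it is an occurrence because every entry
  of L stays below every entry of R.\<close>

lemma consec_occs_join_at_1:
  assumes L: "L permutes {1..m}" and R: "R permutes {1..r}"
  shows "consec_occs pat213 (Suc (m + r)) (join_at_1 m r L R) =
    consec_occs pat213 m L \<union> (\<lambda>i. Suc (m + i)) ` consec_occs pat213 r R
      \<union> (if m = 0 \<or> r = 0 then {} else {m})"
    (is "?lhs = ?rhs")
proof -
  let ?J = "join_at_1 m r L R"
  have J0: "?J i \<ge> 1" if "1 \<le> i" "i \<le> Suc (m + r)" for i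
    using permutes_bounds[OF join_at_1_permutes[OF L R], of i] that by auto
  have "i \<in> ?lhs \<longleftrightarrow> i \<in> ?rhs" for i
  proof -
    \<comment> \<open>The cases from \<open>i + 2 \<le> m\<close> on are: window inside L, 1 at its
      end, 1 in its middle, 1 at its start, start inside R.\<close>
    consider "i = 0" | "i > Suc (m + r)" | "1 \<le> i" "i + 2 \<le> m" | "1 \<le> i" "i + 1 = m" | "i = m" "1 \<le> i"
      | "i = Suc m" | i' where "i = Suc (m + i')" "1 \<le> i'" "i' \<le> r"
    proof -
      have "1 \<le> i \<Longrightarrow> i \<le> Suc (m + r) \<Longrightarrow> thesis"
        by (erule (1) join_index_cases) (use that in \<open>force+\<close>)
      thus thesis using that(1,2) by linarith
    qed
    thus ?thesis
    proof cases
      case 3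
      thus ?thesis by (auto simp: consec_occs_pat213 join_at_1_simps)
    next
      case 4
      hence "?J (i + 2) = 1" using join_at_1_simps(1)[of m] by (simp flip: 4(2))
      hence "i \<notin> ?lhs" using J0[of i] 4 by (auto simp: consec_occs_pat213)
      thus ?thesis using 4 by (auto simp: consec_occs_pat213)
    next
      case 5
      have "i \<in> ?lhs \<longleftrightarrow> r \<noteq> 0"
      proof (cases "r = 0")
        case False
        have "?J i = Suc (L i)" "?J (i + 1) = 1" "?J (i + 2) = R 1 + Suc m"
          using 5 False join_at_1_simps(3)[of 1 r m L R] by (simp_all add: join_at_1_simps)
        thus ?thesis using 5 False permutes_bounds[OF L, of i] permutes_bounds[OF R, of 1]
          by (auto simp: consec_occs_pat213)
      qed (use 5 in \<open>auto simp: consec_occs_pat213\<close>)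
      thus ?thesis using 5 by (auto simp: consec_occs_pat213)
    next
      case 6
      thus ?thesis using J0[of "i + 1"] by (auto simp: consec_occs_pat213 join_at_1_simps)
    next
      case (7 i')
      have "i \<in> ?lhs \<longleftrightarrow> i' \<in> consec_occs pat213 r R"
        using 7 join_at_1_simps(3)[of i' r m L R] join_at_1_simps(3)[of "i' + 1" r m L R]
          join_at_1_simps(3)[of "i' + 2" r m L R]
        by (auto simp: consec_occs_pat213)
      thus ?thesis using 7 by (auto simp: consec_occs_pat213)
    qed (auto simp: consec_occs_pat213)
  qed
  thus ?thesis by blast
qed

text \<open>The three sets are disjoint: occurrences in L start at m-2 or earlier, the new one
  starts at m, and those in R start at m+2 or later.\<close>

lemma card_consec_occs_join_at_1:
  assumes L: "L permutes {1..m}" and R: "R permutes {1..r}"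
  shows "card (consec_occs pat213 (Suc (m + r)) (join_at_1 m r L R)) =
    card (consec_occs pat213 m L) + card (consec_occs pat213 r R)
      + (if m = 0 \<or> r = 0 then 0 else 1)"
proof -
  let ?A = "consec_occs pat213 m L" and ?B = "(\<lambda>i. Suc (m + i)) ` consec_occs pat213 r R"
  let ?C = "if m = 0 \<or> r = 0 then {} else {m}"
  have "card (?A \<union> ?B \<union> ?C) = card (?A \<union> ?B) + card ?C"
    by (rule card_Un_disjoint) (auto simp: finite_consec_occs, auto simp: consec_occs_pat213)
  also have "card (?A \<union> ?B) = card ?A + card ?B"
    by (rule card_Un_disjoint) (auto simp: finite_consec_occs, auto simp: consec_occs_pat213)
  also have "card ?B = card (consec_occs pat213 r R)"
    by (rule card_image) (auto simp: inj_on_def)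
  finally show ?thesis by (simp add: consec_occs_join_at_1[OF assms])
qed

lemma join_at_1_inject:
  assumes "L permutes {1..m}" "L' permutes {1..m}" "R permutes {1..r}" "R' permutes {1..r}"
    and eq: "join_at_1 m r L R = join_at_1 m r L' R'"
  shows "L = L'" "R = R'"
proof -
  show "L = L'"
  proof
    fix i show "L i = L' i"
      using fun_cong[OF eq, of i] assms(1,2)
      by (cases "1 \<le> i \<and> i \<le> m") (auto simp: join_at_1_simps permutes_not_in)
  qed
  show "R = R'"
  proof
    fix i show "R i = R' i"
      using fun_cong[OF eq, of "Suc (m + i)"] assms(3,4)
      by (cases "1 \<le> i \<and> i \<le> r") (auto simp: join_at_1_simps permutes_not_in)
  qed
qed

section \<open>Splitting an avoider at the entry 1\<close>

lemma Av312_split_bounds: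
  assumes \<sigma>: "\<sigma> \<in> Av312 (Suc (m + r))" and one: "\<sigma> (Suc m) = 1"
  shows "1 \<le> i \<Longrightarrow> i \<le> m \<Longrightarrow> \<sigma> i \<le> Suc m"
    and "Suc m < l \<Longrightarrow> l \<le> Suc (m + r) \<Longrightarrow> Suc m < \<sigma> l"
proof -
  let ?N = "Suc (m + r)"
  have perm: "\<sigma> permutes {1..?N}" and av: "avoids_312 ?N \<sigma>"
    using \<sigma> by (auto simp: Av312_def)
  \<comment> \<open>Otherwise \<sigma> i, 1, \<sigma> l would be a 3-1-2 with the entry 1 in the
    middle.\<close>
  have less: "\<sigma> i < \<sigma> l" if "1 \<le> i" "i \<le> m" "Suc m < l" "l \<le> ?N" for i l
  proof -
    have "\<sigma> l \<noteq> 1" "\<sigma> l \<noteq> \<sigma> i" using permutes_eq_iff[OF perm] one that by (metis less_irrefl, auto)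
    moreover have "1 \<le> \<sigma> l" using permutes_bounds[OF perm] that by auto
    moreover have "\<not> (\<sigma> (Suc m) < \<sigma> l \<and> \<sigma> l < \<sigma> i)"
      using av that unfolding avoids_312_def by (meson le_imp_less_Suc)
    ultimately show ?thesis using one by auto
  qed
  have one_le: "\<sigma> (Suc m) < \<sigma> l" if "Suc m < l" "l \<le> ?N" for l
    using permutes_bounds[OF perm, of l] permutes_eq_iff[OF perm, of l "Suc m"] one that by auto
  have inj: "inj_on \<sigma> S" for S using permutes_inj[OF perm] by (rule inj_on_subset) auto
  show "\<sigma> i \<le> Suc m" if i: "1 \<le> i" "i \<le> m"
  proof -
    \<comment> \<open>Pigeonhole: positions beyond m+1 hold values above \<sigma> i, so the values
      up to \<sigma> i share the first m+1 positions.\<close>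
    have "{1..\<sigma> i} \<subseteq> \<sigma> ` {1..Suc m}"
    proof
      fix v assume v: "v \<in> {1..\<sigma> i}"
      hence "v \<in> {1..?N}" using permutes_bounds[OF perm, of i] i by auto
      hence "v \<in> \<sigma> ` {1..?N}" using permutes_image[OF perm] by simp
      then obtain l where l: "v = \<sigma> l" "1 \<le> l" "l \<le> ?N" by auto
      have "l \<le> Suc m" using less[of i l] i l v by force
      thus "v \<in> \<sigma> ` {1..Suc m}" using l by auto
    qed
    hence "card {1..\<sigma> i} \<le> card (\<sigma> ` {1..Suc m})" by (intro card_mono) auto
    thus ?thesis by (simp add: card_image[OF inj])
  qed
  show "Suc m < \<sigma> l" if l: "Suc m < l" "l \<le> ?N"
  proof -
    \<comment> \<open>Pigeonhole again: the m+1 values at the first positions all lie below \<sigma>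
      l.\<close>
    have "\<sigma> ` {1..Suc m} \<subseteq> {1..<\<sigma> l}"
    proof
      fix v assume "v \<in> \<sigma> ` {1..Suc m}"
      then obtain i where i: "v = \<sigma> i" "1 \<le> i" "i \<le> Suc m" by auto
      have "v < \<sigma> l" using less[of i l] one_le[of l] i l by (cases "i = Suc m") auto
      moreover have "1 \<le> v" using permutes_bounds[OF perm, of i] i by simp
      ultimately show "v \<in> {1..<\<sigma> l}" by simp
    qed
    hence "card (\<sigma> ` {1..Suc m}) \<le> card {1..<\<sigma> l}" by (intro card_mono) auto
    thus ?thesis by (simp add: card_image[OF inj])
  qed
qed

lemma Av312_decompose:
  assumes \<sigma>: "\<sigma> \<in> Av312 (Suc (m + r))" and one: "\<sigma> (Suc m) = 1"
  obtains L R where "L \<in> Av312 m" "R \<in> Av312 r" "\<sigma> = join_at_1 m r L R"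
proof -
  let ?N = "Suc (m + r)"
  have perm: "\<sigma> permutes {1..?N}" and av: "avoids_312 ?N \<sigma>"
    using \<sigma> by (auto simp: Av312_def)
  \<comment> \<open>Both parts undo the shifts of \<open>join_at_1\<close>; the bounds
    \<open>lo\<close> and \<open>hi\<close> ensure that the subtractions do not truncate.\<close>
  define L where "L i = (if 1 \<le> i \<and> i \<le> m then \<sigma> i - 1 else i)" for i
  define R where "R i = (if 1 \<le> i \<and> i \<le> r then \<sigma> (Suc (m + i)) - Suc m else i)" for i
  have lo: "2 \<le> \<sigma> i \<and> \<sigma> i \<le> Suc m" if "1 \<le> i" "i \<le> m" for i
    using Av312_split_bounds(1)[OF assms, of i] that permutes_bounds[OF perm, of i]
      permutes_eq_iff[OF perm, of i "Suc m"] one by force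
  have hi: "Suc m < \<sigma> (Suc (m + i)) \<and> \<sigma> (Suc (m + i)) \<le> ?N" if "1 \<le> i" "i \<le> r" for i
    using Av312_split_bounds(2)[OF assms, of "Suc (m + i)"] that
      permutes_bounds[OF perm, of "Suc (m + i)"] by auto
  have L: "L permutes {1..m}"
  proof (rule permutes_atLeastAtMostI)
    show "inj_on L {1..m}"
    proof (rule inj_onI)
      fix i j assume *: "i \<in> {1..m}" "j \<in> {1..m}" "L i = L j"
      hence "\<sigma> i = \<sigma> j" using lo[of i] lo[of j] by (auto simp: L_def)
      thus "i = j" by (simp add: permutes_eq_iff[OF perm])
    qed
    show "1 \<le> L i \<and> L i \<le> m" if "1 \<le> i" "i \<le> m" for i
      using lo[OF that] that by (auto simp: L_def)
  qed (auto simp: L_def)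
  have R: "R permutes {1..r}"
  proof (rule permutes_atLeastAtMostI)
    show "inj_on R {1..r}"
    proof (rule inj_onI)
      fix i j assume *: "i \<in> {1..r}" "j \<in> {1..r}" "R i = R j"
      hence "\<sigma> (Suc (m + i)) = \<sigma> (Suc (m + j))" using hi[of i] hi[of j] by (auto simp: R_def)
      thus "i = j" by (simp add: permutes_eq_iff[OF perm])
    qed
    show "1 \<le> R i \<and> R i \<le> r" if "1 \<le> i" "i \<le> r" for i
      using hi[OF that] that by (auto simp: R_def)
  qed (auto simp: R_def)
  have eq: "\<sigma> = join_at_1 m r L R"
  proof
    fix i
    show "\<sigma> i = join_at_1 m r L R i"
    proof (cases "1 \<le> i \<and> i \<le> ?N")
      case True
      hence "1 \<le> i" "i \<le> ?N" by auto
      thus ?thesis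
      proof (cases rule: join_index_cases)
        case left
        thus ?thesis using lo[of i] by (simp add: join_at_1_simps L_def)
      next
        case (right i')
        thus ?thesis using hi[of i'] by (simp add: join_at_1_simps R_def)
      qed (simp add: join_at_1_simps one)
    next
      case False
      hence "\<sigma> i = i" using permutes_not_in[OF perm] by auto
      thus ?thesis using False by (auto simp: join_at_1_def)
    qed
  qed
  have "avoids_312 m L" "avoids_312 r R"
    using av avoids_312_join_at_1[OF L R] by (simp_all add: eq)
  thus thesis using that L R eq by (auto simp: Av312_def)
qed

text \<open>Turns a sum over the avoiders with m entries before the 1 into a sum over independent
  pairs of smaller avoiders.\<close>

lemma bij_betw_join_at_1:
  "bij_betw (\<lambda>(L, R). join_at_1 m r L R) (Av312 m \<times> Av312 r)
     {\<sigma> \<in> Av312 (Suc (m + r)). \<sigma> (Suc m) = 1}"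
  unfolding bij_betw_def
proof
  show "inj_on (\<lambda>(L, R). join_at_1 m r L R) (Av312 m \<times> Av312 r)"
    unfolding inj_on_def Av312_def using join_at_1_inject by fast
  show "(\<lambda>(L, R). join_at_1 m r L R) ` (Av312 m \<times> Av312 r) =
      {\<sigma> \<in> Av312 (Suc (m + r)). \<sigma> (Suc m) = 1}"
  proof (intro equalityI subsetI)
    fix \<sigma> assume "\<sigma> \<in> (\<lambda>(L, R). join_at_1 m r L R) ` (Av312 m \<times> Av312 r)"
    thus "\<sigma> \<in> {\<sigma> \<in> Av312 (Suc (m + r)). \<sigma> (Suc m) = 1}"
      by (auto simp: Av312_def join_at_1_permutes avoids_312_join_at_1 join_at_1_simps
          simp del: One_nat_def)
  next
    fix \<sigma> assume "\<sigma> \<in> {\<sigma> \<in> Av312 (Suc (m + r)). \<sigma> (Suc m) = 1}"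
    thus "\<sigma> \<in> (\<lambda>(L, R). join_at_1 m r L R) ` (Av312 m \<times> Av312 r)"
      by (auto elim!: Av312_decompose)
  qed
qed

section \<open>The functional equation\<close>

text \<open>The coefficient of t^n in A, a polynomial in z; \<open>fps_X\<close> stands for z
  here.\<close>

definition weight213 :: "nat \<Rightarrow> rat fps" where
  "weight213 n = (\<Sum>\<sigma>\<in>Av312 n. fps_X ^ card (consec_occs pat213 n \<sigma>))"

lemma weight213_nth: "weight213 n $ k = of_nat (a213 n k)"
proof -
  have "weight213 n $ k = (\<Sum>\<sigma>\<in>Av312 n. if card (consec_occs pat213 n \<sigma>) = k then 1 else 0)"
    by (auto simp: weight213_def fps_sum_nth intro!: sum.cong)
  also have "\<dots> = of_nat (a213 n k)"
    by (simp add: a213_def sum.If_cases finite_Av312 Int_def)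
  finally show ?thesis .
qed

lemma weight213_0: "weight213 0 = 1"
proof -
  have "Av312 0 = {id}" by (auto simp: Av312_def avoids_312_def)
  thus ?thesis by (simp add: weight213_def consec_occs_def)
qed

text \<open>Avoiders are sorted by the number m of entries before the 1. The factor z records the
  occurrence centred at the 1, present exactly when both parts are nonempty.\<close>

lemma weight213_Suc:
  "weight213 (Suc n) =
     (\<Sum>m\<le>n. (if m = 0 \<or> m = n then 1 else fps_X) * weight213 m * weight213 (n - m))"
proof -
  let ?w = "\<lambda>n \<sigma>. fps_X ^ card (consec_occs pat213 n \<sigma>) :: rat fps"
  let ?S = "\<lambda>m. {\<sigma> \<in> Av312 (Suc n). \<sigma> (Suc m) = 1}"
  have "Av312 (Suc n) = (\<Union>m\<in>{..n}. ?S m)"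
  proof (intro equalityI subsetI)
    fix \<sigma> assume *: "\<sigma> \<in> Av312 (Suc n)"
    hence p: "\<sigma> permutes {1..Suc n}" by (simp add: Av312_def)
    have "1 \<in> \<sigma> ` {1..Suc n}" using permutes_image[OF p] by simp
    then obtain i where "1 \<le> i" "i \<le> Suc n" "\<sigma> i = 1" by auto
    thus "\<sigma> \<in> (\<Union>m\<in>{..n}. ?S m)" using * by (auto intro!: bexI[of _ "i - 1"])
  qed auto
  hence "weight213 (Suc n) = (\<Sum>\<sigma>\<in>(\<Union>m\<in>{..n}. ?S m). ?w (Suc n) \<sigma>)"
    by (simp add: weight213_def)
  also have "\<dots> = (\<Sum>m\<le>n. \<Sum>\<sigma>\<in>?S m. ?w (Suc n) \<sigma>)"
  proof (rule sum.UNION_disjoint)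
    show "\<forall>i\<in>{..n}. \<forall>j\<in>{..n}. i \<noteq> j \<longrightarrow> ?S i \<inter> ?S j = {}"
    proof (intro ballI impI equals0I)
      fix i j \<sigma> assume "i \<noteq> j" and \<sigma>: "\<sigma> \<in> ?S i \<inter> ?S j"
      hence "\<sigma> permutes {1..Suc n}" "\<sigma> (Suc i) = \<sigma> (Suc j)" by (auto simp: Av312_def)
      thus False using \<open>i \<noteq> j\<close> by (simp add: permutes_eq_iff)
    qed
  qed (auto simp: finite_Av312)
  also have "\<dots> = (\<Sum>m\<le>n. (if m = 0 \<or> m = n then 1 else fps_X) * weight213 m * weight213 (n - m))"
  proof (rule sum.cong)
    fix m assume "m \<in> {..n}"
    then obtain r where r: "n = m + r" using le_Suc_ex by auto
    have "(\<Sum>\<sigma>\<in>?S m. ?w (Suc n) \<sigma>) =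
        (\<Sum>(L, R)\<in>Av312 m \<times> Av312 r. ?w (Suc n) (join_at_1 m r L R))"
      using sum.reindex_bij_betw[OF bij_betw_join_at_1[of m r], of "?w (Suc n)"]
      by (simp add: r case_prod_unfold)
    also have "\<dots> = (\<Sum>(L, R)\<in>Av312 m \<times> Av312 r.
        (if m = 0 \<or> r = 0 then 1 else fps_X) * (?w m L * ?w r R))"
    proof (rule sum.cong[OF refl], clarify)
      fix L R assume "L \<in> Av312 m" "R \<in> Av312 r"
      hence "L permutes {1..m}" "R permutes {1..r}" by (auto simp: Av312_def)
      thus "?w (Suc n) (join_at_1 m r L R) =
          (if m = 0 \<or> r = 0 then 1 else fps_X) * (?w m L * ?w r R)"
        unfolding r by (simp only: card_consec_occs_join_at_1) (simp add: power_add)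
    qed
    also have "\<dots> = (if m = 0 \<or> r = 0 then 1 else fps_X) * (weight213 m * weight213 r)"
      unfolding weight213_def sum_product sum.cartesian_product
      by (simp only: sum_distrib_left case_prod_unfold)
    finally show "(\<Sum>\<sigma>\<in>?S m. ?w (Suc n) \<sigma>) =
        (if m = 0 \<or> m = n then 1 else fps_X) * weight213 m * weight213 (n - m)"
      by (simp add: r mult.assoc)
  qed simp
  finally show ?thesis .
qed

text \<open>The coefficient of t^n in B = A - 1.\<close>

definition weight213_pos :: "nat \<Rightarrow> rat fps" where
  "weight213_pos n = (if n = 0 then 0 else weight213 n)"

lemma weight213_pos_0 [simp]: "weight213_pos 0 = 0"
  by (simp add: weight213_pos_def)

text \<open>The equation B = t (1 + 2 B + z B^2) at t^(n+1). The summands m = 0 and m = n have an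
  empty part and give 2 B; for n = 0 they coincide and give the 1. In the convolution they vanish,
  so it may run over all m.\<close>

lemma weight213_pos_Suc:
  "weight213_pos (Suc n) = (if n = 0 then 1 else 0) + 2 * weight213_pos n
     + fps_X * (\<Sum>m\<le>n. weight213_pos m * weight213_pos (n - m))"
proof (cases "n = 0")
  case True
  thus ?thesis by (simp add: weight213_pos_def weight213_Suc weight213_0)
next
  case False
  have split: "{..n} = insert 0 (insert n {1..<n})" using False by auto
  show ?thesis using False
    by (simp add: weight213_pos_def weight213_Suc split weight213_0 sum_distrib_left mult.assoc)
qed

section \<open>Extracting the powers of \<open>z\<close>\<close>

lemma fps_const_sum: "fps_const (sum f A) = (\<Sum>x\<in>A. fps_const (f x))"
  by (rule fps_ext) (simp add: fps_sum_nth)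

section \<open>The Catalan recurrence\<close>

text \<open>These are the coefficients of the square root of 1 - 4 x beyond the constant term. Both
  sides satisfy (k + 2) a(k+1) = (4 k + 2) a(k).\<close>

lemma catalan_eq_gbinomial:
  "(1 / 2 gchoose Suc k) * (-4) ^ Suc k = - 2 * catalan k"
proof (induction k)
  case (Suc k)
  have 1: "of_nat (Suc (Suc k)) * ((1 / 2 :: rat) gchoose Suc (Suc k)) =
      (1 / 2 - of_nat (Suc k)) * (1 / 2 gchoose Suc k)"
    using gbinomial_absorb_comp[of "1 / 2 :: rat" "Suc k"]
      gbinomial_absorption[of "Suc k" "1 / 2 :: rat"]
    by simp
  \<comment> \<open>The ratio of consecutive central binomials, from two absorptions and the
    symmetry of row 2k+1; the common factor k+1 is cancelled last.\<close>
  have "((2 * Suc k) choose Suc k) * (k + 1) = 2 * (2 * k + 1) * ((2 * k) choose k)"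
  proof -
    have "Suc k * (Suc (2 * k + 1) choose Suc k) = Suc (2 * k + 1) * ((2 * k + 1) choose k)"
      by (rule Suc_times_binomial)
    moreover have "Suc k * (Suc (2 * k) choose Suc k) = Suc (2 * k) * ((2 * k) choose k)"
      by (rule Suc_times_binomial)
    moreover have "Suc (2 * k) choose Suc k = Suc (2 * k) choose k"
      by (subst binomial_symmetric) auto
    ultimately have "Suc k * (Suc k * ((2 * Suc k) choose Suc k)) =
        Suc k * (2 * (2 * k + 1) * ((2 * k) choose k))"
      by (simp add: algebra_simps)
    thus ?thesis by (simp only: mult_cancel1) (simp add: mult.commute)
  qed
  hence *: "of_nat (((2 * Suc k) choose Suc k) * (k + 1)) =
      (of_nat (2 * (2 * k + 1) * ((2 * k) choose k)) :: rat)"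
    by (simp only:)
  have 2: "of_nat (k + 2) * catalan (Suc k) = 2 * (2 * of_nat k + 1) * catalan k"
  proof -
    define x y :: rat
      where "x = of_nat ((2 * Suc k) choose Suc k)" and "y = of_nat ((2 * k) choose k)"
    have "x * (of_nat k + 1) = 2 * (2 * of_nat k + 1) * y"
      using * unfolding of_nat_mult x_def[symmetric] y_def[symmetric] by (simp add: add.commute)
    thus ?thesis
      unfolding catalan_def x_def[symmetric] y_def[symmetric]
      by (simp add: divide_simps) (simp add: algebra_simps)
  qed
  have "of_nat (Suc (Suc k)) * ((1 / 2 gchoose Suc (Suc k)) * (-4) ^ Suc (Suc k)) =
      (of_nat (Suc (Suc k)) * ((1 / 2 :: rat) gchoose Suc (Suc k))) * (-4) ^ Suc (Suc k)"
    by simp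
  also have "\<dots> = (4 * of_nat k + 2) * ((1 / 2 gchoose Suc k) * (-4) ^ Suc k)"
    unfolding 1 by (simp add: algebra_simps)
  also have "\<dots> = of_nat (Suc (Suc k)) * (- 2 * catalan (Suc k))"
    unfolding Suc using 2 by (simp add: algebra_simps)
  finally show ?case by (metis mult_cancel_left of_nat_neq_0)
qed (simp add: catalan_def)

text \<open>
  Vandermonde's identity for \<open>(1 - 4 x)\<^bsup>1/2\<^esup> (1 - 4 x)\<^bsup>1/2\<^esup> = 1 - 4 x\<close>: the two boundary terms
  of the sum are \<open>- 2 C\<^sub>k\<^sub>+\<^sub>1\<close> each, and the coefficient of \<open>x\<^bsup>k+2\<^esup>\<close> on the right is zero.
\<close>
lemma catalan_Suc: "catalan (Suc k) = (\<Sum>i\<le>k. catalan i * catalan (k - i))"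
proof -
  define s :: "nat \<Rightarrow> rat" where "s i = (1 / 2 gchoose i) * (-4) ^ i" for i
  have s_Suc: "s (Suc i) = - 2 * catalan i" for i
    unfolding s_def by (rule catalan_eq_gbinomial)
  have "(\<Sum>i\<le>Suc (Suc k). s i * s (Suc (Suc k) - i)) =
      (\<Sum>i\<le>Suc (Suc k). (1 / 2 gchoose i) * (1 / 2 gchoose (Suc (Suc k) - i)) * (-4) ^ Suc (Suc k))"
  proof (rule sum.cong)
    fix i assume "i \<in> {..Suc (Suc k)}"
    hence "(-4 :: rat) ^ Suc (Suc k) = (-4) ^ i * (-4) ^ (Suc (Suc k) - i)"
      by (simp flip: power_add)
    thus "s i * s (Suc (Suc k) - i) =
        (1 / 2 gchoose i) * (1 / 2 gchoose (Suc (Suc k) - i)) * (-4) ^ Suc (Suc k)"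
      by (simp add: s_def)
  qed simp
  also have "\<dots> = ((1 :: rat) gchoose Suc (Suc k)) * (-4) ^ Suc (Suc k)"
    using gbinomial_Vandermonde[of "1 / 2 :: rat" "1 / 2" "Suc (Suc k)"]
    by (simp only: sum_distrib_right[symmetric] atMost_atLeast0) simp
  also have "(1 :: rat) gchoose Suc (Suc k) = 0"
    using binomial_gbinomial[of 1 "Suc (Suc k)", where ?'a = rat] by simp
  finally have "0 = (\<Sum>i\<le>Suc (Suc k). s i * s (Suc (Suc k) - i))" by simp
  also have "\<dots> = 2 * s 0 * s (Suc (Suc k)) + (\<Sum>i\<le>k. s (Suc i) * s (Suc (k - i)))"
  proof -
    have "(\<Sum>i\<le>Suc (Suc k). s i * s (Suc (Suc k) - i)) =
        s 0 * s (Suc (Suc k)) + (\<Sum>i\<le>Suc k. s (Suc i) * s (Suc k - i))"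
      by (subst sum.atMost_Suc_shift) simp
    also have "(\<Sum>i\<le>Suc k. s (Suc i) * s (Suc k - i)) =
        (\<Sum>i\<le>k. s (Suc i) * s (Suc (k - i))) + s (Suc (Suc k)) * s 0"
      by (simp add: Suc_diff_le)
    finally show ?thesis by simp
  qed
  also have "\<dots> = 4 * ((\<Sum>i\<le>k. catalan i * catalan (k - i)) - catalan (Suc k))"
    by (simp add: s_Suc sum_distrib_left algebra_simps) (simp add: s_def)
  finally show ?thesis by simp
qed

section \<open>Powers of x / (1 - 2 x)\<close>

text \<open>With \<open>P j\<close> standing for x^j / (1 - 2 x)^(j+1), Pascal's rule gives (1 - 2
  x) P(j+1) = x P(j), so each further factor u raises j by one.\<close>

lemma geometric_power_nth:
  fixes u :: "rat fps"
  defines "u \<equiv> fps_X * Abs_fps (\<lambda>n. 2 ^ n)"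
  shows "u ^ Suc j = fps_X * Abs_fps (\<lambda>n. of_nat (n choose j) * 2 ^ (n - j))"
proof (induction j)
  case (Suc j)
  define P :: "nat \<Rightarrow> rat fps" where
    "P j = Abs_fps (\<lambda>n. of_nat (n choose j) * 2 ^ (n - j))" for j
  have P0: "(1 - 2 * fps_X) * P 0 = 1"
    by (rule fps_ext, rename_tac n, case_tac n)
       (auto simp: P_def left_diff_distrib mult.assoc numeral_fps_const)
  have PS: "(1 - 2 * fps_X) * P (Suc j) = fps_X * P j"
  proof (rule fps_ext)
    fix n
    show "((1 - 2 * fps_X) * P (Suc j)) $ n = (fps_X * P j) $ n"
    proof (cases n)
      case (Suc n')
      \<comment> \<open>The exponents \<open>n' - j\<close> and \<open>n' - Suc j\<close> truncate
        differently; where one of them truncates to 0 improperly, its binomial vanishes.\<close>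
      consider "n' < j" | "n' = j" | d where "n' = Suc (j + d)"
        by (metis less_iff_Suc_add linorder_neqE_nat)
      thus ?thesis
        by cases (auto simp: P_def left_diff_distrib mult.assoc numeral_fps_const Suc algebra_simps)
    qed (simp add: P_def left_diff_distrib mult.assoc numeral_fps_const)
  qed
  have u: "u = fps_X * P 0" by (simp add: u_def P_def)
  have "u * (fps_X * P j) = fps_X * P 0 * ((1 - 2 * fps_X) * P (Suc j))"
    unfolding u PS ..
  also have "\<dots> = fps_X * P (Suc j) * ((1 - 2 * fps_X) * P 0)" by (simp only: ac_simps)
  finally have "u * (fps_X * P j) = fps_X * P (Suc j)" using P0 by simp
  thus ?case using Suc by (simp add: P_def)
qed (simp add: u_def)

section \<open>The coefficient of z^k\<close>

text \<open>The coefficient of z^k in B as a series in t; from here on \<open>fps_X\<close> on such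
  series stands for t.\<close>

definition z_slice :: "nat \<Rightarrow> rat fps" where
  "z_slice k = Abs_fps (\<lambda>n. weight213_pos n $ k)"

text \<open>The functional equation at z^0 gives (1 - 2 t) B_0 = t, and at z^(k+1) it gives (1 - 2
  t) B_(k+1) = t times the convolution of the earlier slices. Dividing by 1 - 2 t leaves the Catalan
  recurrence with a factor u.\<close>

lemma z_slice_eq:
  defines "u \<equiv> fps_X * Abs_fps (\<lambda>n. 2 ^ n) :: rat fps"
  shows "z_slice k = fps_const (catalan k) * u ^ Suc (2 * k)"
proof -
  define P :: "rat fps" where "P = Abs_fps (\<lambda>n. 2 ^ n)"
  have P: "P * (1 - 2 * fps_X) = 1"
    by (rule fps_ext, rename_tac n, case_tac n)
       (auto simp: P_def right_diff_distrib numeral_fps_const mult.left_commute)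
  have u: "u = fps_X * P" by (simp add: u_def P_def)
  have solve: "F = u * H" if "(1 - 2 * fps_X) * F = fps_X * H" for F H :: "rat fps"
  proof -
    have "F = P * (1 - 2 * fps_X) * F" using P by simp
    also have "\<dots> = P * (fps_X * H)" by (simp only: mult.assoc that)
    finally show ?thesis by (simp add: u ac_simps)
  qed
  have z0: "z_slice 0 = u * 1"
  proof (rule solve, rule fps_ext)
    fix n
    show "((1 - 2 * fps_X) * z_slice 0) $ n = (fps_X * 1) $ n"
      by (cases n) (auto simp: z_slice_def left_diff_distrib mult.assoc numeral_fps_const
          weight213_pos_Suc)
  qed
  have zS: "z_slice (Suc k) = u * (\<Sum>i\<le>k. z_slice i * z_slice (k - i))" for k
  proof (rule solve, rule fps_ext)
    fix n
    show "((1 - 2 * fps_X) * z_slice (Suc k)) $ n =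
        (fps_X * (\<Sum>i\<le>k. z_slice i * z_slice (k - i))) $ n"
    proof (cases n)
      case (Suc n')
      \<comment> \<open>The coefficient of t^n' z^k in B^2, expanded first in t or first in
        z.\<close>
      have "(\<Sum>i\<le>n'. weight213_pos i * weight213_pos (n' - i)) $ k =
          (\<Sum>i\<le>k. z_slice i * z_slice (k - i)) $ n'"
        by (simp add: fps_sum_nth fps_mult_nth z_slice_def atLeast0AtMost) (rule sum.swap)
      thus ?thesis
        by (simp add: Suc z_slice_def left_diff_distrib mult.assoc numeral_fps_const
            weight213_pos_Suc)
    qed (simp add: z_slice_def left_diff_distrib mult.assoc numeral_fps_const)
  qed
  show ?thesis
  proof (induction k rule: less_induct)
    case (less k)
    show ?case
    proof (cases k)
      case 0
      thus ?thesis using z0 by (simp add: catalan_def)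
    next
      case (Suc k')
      have "z_slice k = u * (\<Sum>i\<le>k'. fps_const (catalan i * catalan (k' - i)) * u ^ (2 * k' + 2))"
        unfolding Suc zS
      proof (intro arg_cong[where f = "(*) u"] sum.cong refl)
        fix i assume i: "i \<in> {..k'}"
        \<comment> \<open>The exponents 2i+1 and 2(k'-i)+1 add up to 2k'+2 for every i, so this
          power of u leaves the sum.\<close>
        have "u ^ (2 * k' + 2) = u ^ Suc (2 * i) * u ^ Suc (2 * (k' - i))"
          unfolding power_add[symmetric] using i by (intro arg_cong[where f = "(^) u"]) auto
        thus "z_slice i * z_slice (k' - i) =
            fps_const (catalan i * catalan (k' - i)) * u ^ (2 * k' + 2)"
          using i less[of i] less[of "k' - i"] Suc
          by (simp only: fps_const_mult[symmetric]) (simp add: ac_simps)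
      qed
      also have "\<dots> = u * (fps_const (catalan k) * u ^ (2 * k' + 2))"
        by (simp add: Suc catalan_Suc sum_distrib_right fps_const_sum del: power_Suc fps_const_mult)
      finally show ?thesis by (simp add: Suc ac_simps)
    qed
  qed
qed

lemma a213_eq:
  assumes "n \<ge> 1"
  shows "of_nat (a213 n k) =
    2 powi (int n - 2 * int k - 1) * catalan k * of_nat ((n - 1) choose (2 * k))"
proof -
  obtain n' where n: "n = Suc n'" using assms by (cases n) auto
  have "of_nat (a213 n k) = z_slice k $ n"
    by (simp add: z_slice_def weight213_pos_def n weight213_nth)
  also have "\<dots> = catalan k * (of_nat (n' choose (2 * k)) * 2 ^ (n' - 2 * k))"
    unfolding z_slice_eq geometric_power_nth by (simp add: n)
  also have "\<dots> = 2 powi (int n - 2 * int k - 1) * catalan k * of_nat ((n - 1) choose (2 * k))"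
  \<comment> \<open>For 2k > n' the binomial makes both sides 0, although one exponent truncates and
    the other is negative.\<close>
  proof (cases "2 * k \<le> n'")
    case True
    hence "int n - 2 * int k - 1 = int (n' - 2 * k)" by (simp add: n)
    hence "(2 :: rat) powi (int n - 2 * int k - 1) = 2 ^ (n' - 2 * k)"
      by (simp only: power_int_of_nat)
    thus ?thesis by (simp add: n)
  qed (simp add: n binomial_eq_0)
  finally show ?thesis .
qed

section \<open>The closed form\<close>

lemma fps_to_fls_sum: "fps_to_fls (sum f A) = (\<Sum>x\<in>A. fps_to_fls (f x))"
  by (induction A rule: infinite_finite_induct) simp_all

lemma embed_A213_closed_form:
  "embed_z A213 =
     (1 - 2 * var_t + 2 * var_t * var_z
        - fps_sqrt ((1 - 2 * var_t)^2 - 4 * var_t^2 * var_z)) / (2 * var_t * var_z)"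
proof -
  define B :: "rat fls fps" where "B = Abs_fps (\<lambda>n. fps_to_fls (weight213_pos n))"
  have "A213 $ n = weight213 n" for n
    by (rule fps_ext) (simp add: A213_def weight213_nth)
  hence A: "embed_z A213 = 1 + B"
    by (intro fps_ext) (auto simp: embed_z_def B_def weight213_pos_def weight213_0)
  have B: "B = var_t * (1 + 2 * B + var_z * B\<^sup>2)"
  proof (rule fps_ext)
    fix n
    show "B $ n = (var_t * (1 + 2 * B + var_z * B\<^sup>2)) $ n"
    proof (cases n)
      case (Suc n')
      have "fps_to_fls (\<Sum>m\<le>n'. weight213_pos m * weight213_pos (n' - m)) = B\<^sup>2 $ n'"
        by (simp add: B_def power2_eq_square fps_mult_nth atLeast0AtMost fls_times_fps_to_fls
            fps_to_fls_sum)
      thus ?thesis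
        by (simp add: Suc var_t_def var_z_def numeral_fps_const B_def weight213_pos_Suc
            fls_times_fps_to_fls)
    qed (simp add: B_def var_t_def)
  qed
  \<comment> \<open>The quadratic t z B^2 - (1 - 2 t) B + t = 0 has discriminant F; completing the
    square gives this root of F, and its constant term 1 fixes the branch.\<close>
  define S where "S = 1 - 2 * var_t - 2 * var_t * var_z * B"
  define F :: "rat fls fps" where "F = (1 - 2 * var_t)^2 - 4 * var_t^2 * var_z"
  have "F $ 0 = 1" by (simp add: F_def var_t_def power2_eq_square)
  moreover have "S $ 0 = 1" by (simp add: S_def var_t_def)
  moreover have "S ^ 2 = F"
  proof -
    \<comment> \<open>The difference is a multiple of the defect of the functional equation, hence
      zero.\<close>
    have "S ^ 2 - F = 4 * var_t * var_z * (var_t * (1 + 2 * B + var_z * B\<^sup>2) - B)"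
      by (simp add: S_def F_def power2_eq_square algebra_simps)
    thus ?thesis using B by simp
  qed
  ultimately have S: "fps_sqrt F = S" using fps_sqrt_unique by metis
  have "1 - 2 * var_t + 2 * var_t * var_z - fps_sqrt F = (2 * var_t * var_z) * (1 + B)"
    unfolding S by (simp add: S_def algebra_simps)
  moreover have "2 * var_t * var_z \<noteq> 0" by (simp add: var_t_def var_z_def)
  ultimately show ?thesis unfolding A F_def by (metis nonzero_mult_div_cancel_left)
qed

theorem theorem1:
  shows "embed_z A213 =
           (1 - 2 * var_t + 2 * var_t * var_z
              - fps_sqrt ((1 - 2 * var_t)^2 - 4 * var_t^2 * var_z)) / (2 * var_t * var_z)
         \<and> (\<forall>n k. n \<ge> 1 \<longrightarrow>
              of_nat (a213 n k) =
                2 powi (int n - 2 * int k - 1) * catalan k * of_nat ((n - 1) choose (2 * k)))"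
  using embed_A213_closed_form a213_eq by blast

end
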